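(* Let $F$ be a finite non-empty set of positive integers, and let $\{s_j : j\in F\}$ be a set of real variables, each exceeding $1$. For each ordered set partition $\vec P=(P_1,\dots,P_{|\vec P|})$ of $F$ let $c_{\vec P}$ be a real number depending only on $\vec P$ (not on the variables $s_j$). Suppose that for all real values $s_j>1$ $(j\in F)$, $$\sum_{\vec P} c_{\vec P}\ \zeta\Big(\sum_{j\in P_1}s_j,\ \sum_{j\in P_2}s_j,\ \dots,\ \sum_{j\in P_{|\vec P|}}s_j\Big)=0,$$ where the sum is over all ordered set partitions $\vec P$ of $F$. Then $c_{\vec P}=0$ for every ordered set partition $\vec P$ of $F$.
   Context: Multiple zeta function: for a positive integer $m$ and real $t_1,\dots,t_m$ with $t_1>1$ and $t_j\ge 1$ for all $j$, $$\zeta(t_1,\dots,t_m)=\sum_{k_1>k_2>\cdots>k_m>0}\ \prod_{j=1}^m k_j^{-t_j},$$ the sum being over all positive integers $k_1,\dots,k_m$ satisfying the indicated inequalities. An ordered set partition of a finite non-empty set $F$ is a finite ordered tuple $\vec P=(P_1,\dots,P_m)$ of pairwise disjoint non-empty subsets of $F$ whose union is $F$; $P_k$ is its $k$-th component and $|\vec P|=m$ is its number of components. *)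

theory Defs
  imports "HOL-Analysis.Analysis"
begin

definition decreasing_tuples :: "nat \<Rightarrow> nat list set" where
  "decreasing_tuples m =
     {ks. length ks = m \<and> sorted_wrt (>) ks \<and> (\<forall>k\<in>set ks. 0 < k)}"

(* The arguments t_1, ..., t_m are the entries of ts, so t_j is ts ! (j - 1).
   The series has non-negative terms, hence its order of summation is immaterial and
   infsum is its value whenever it converges, in particular if t_1 > 1 and all
   t_j >= 1.  Outside the domain of convergence infsum takes the value 0. *)
definition multi_zeta :: "real list \<Rightarrow> real" where
  "multi_zeta ts =
     (\<Sum>\<^sub>\<infinity>ks\<in>decreasing_tuples (length ts). \<Prod>j<length ts. real (ks ! j) powr (- (ts ! j)))"

definition ordered_set_partitions :: "'a set \<Rightarrow> 'a set list set" where
  "ordered_set_partitions F =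
     {P. (\<forall>i<length P. P ! i \<noteq> {}) \<and>
         (\<forall>i<length P. \<forall>j<length P. i \<noteq> j \<longrightarrow> P ! i \<inter> P ! j = {}) \<and>
         (\<Union>i<length P. P ! i) = F}"

lemma finite_ordered_set_partitions:
  assumes "finite F"
  shows "finite (ordered_set_partitions F)"
proof (rule finite_subset)
  show "ordered_set_partitions F \<subseteq> {P. set P \<subseteq> Pow F \<and> distinct P}"
  proof
    fix P assume "P \<in> ordered_set_partitions F"
    then have ne: "\<And>i. i < length P \<Longrightarrow> P ! i \<noteq> {}"
      and dj: "\<And>i j. i < length P \<Longrightarrow> j < length P \<Longrightarrow> i \<noteq> j \<Longrightarrow> P ! i \<inter> P ! j = {}"
      and un: "(\<Union>i<length P. P ! i) = F"
      by (auto simp: ordered_set_partitions_def)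
    have "distinct P"
      unfolding distinct_conv_nth using ne dj by (metis inf.idem)
    moreover have "set P \<subseteq> Pow F"
      using un by (auto simp: in_set_conv_nth)
    ultimately show "P \<in> {P. set P \<subseteq> Pow F \<and> distinct P}" by simp
  qed
  show "finite {P. set P \<subseteq> Pow F \<and> distinct P}"
    using assms by (intro finite_subset_distinct) simp
qed

end

theory Submission
  imports Defs
begin

text \<open>A function \<open>f\<close> from \<open>F\<close> to the positive integers induces an ordered set partition of \<open>F\<close>: its
  level sets, in decreasing order of the value of \<open>f\<close>.  A decreasing tuple
  \<open>k\<^sub>1 > \<dots> > k\<^sub>m > 0\<close> together with an ordered set partition \<open>P\<close> into \<open>m\<close> blocks amounts to the same
  thing as a function \<open>f\<close> that induces \<open>P\<close>, namely the one with value \<open>k\<^sub>i\<close> on the \<open>i\<close>-th block, and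
  the summand of the multiple zeta value becomes the product of all \<open>f j powr - s j\<close>
  (\<open>multi_zeta_eq_sum_over_functions\<close>).  Hence the given linear combination is a single multiple
  Dirichlet series, summed over all functions \<open>f\<close>, in which the coefficient of \<open>f\<close> is \<open>c P\<close> for
  the partition \<open>P\<close> that \<open>f\<close> induces.

  An absolutely convergent multiple Dirichlet series that vanishes identically has only zero
  coefficients (\<open>multi_dirichlet_coeffs_zero\<close>, by induction on the number of variables from
  \<open>dirichlet_coeffs_zero\<close>).  Every ordered set partition is induced by some function, so every
  \<open>c P\<close> occurs among the coefficients.\<close>

section \<open>Uniqueness of Dirichlet coefficients\<close>

lemma powr_neg_summable_on:
  assumes "1 < u"
  shows "(\<lambda>n::nat. real n powr - u) summable_on A"
proof -
  have "summable (\<lambda>n::nat. real n powr - u)"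
    using assms by (subst summable_real_powr_iff) auto
  then have "(\<lambda>n::nat. real n powr - u) summable_on UNIV"
    by (intro norm_summable_imp_summable_on) simp
  then show ?thesis
    by (rule summable_on_subset) auto
qed

text \<open>A bound on the coefficients is a property that survives summing out all variables but one:
  the second estimate shows that the resulting one-variable coefficients are bounded again.\<close>

lemma bounded_times_summable_on:
  fixes a g :: "'a \<Rightarrow> real"
  assumes "g summable_on A" and "\<And>x. x \<in> A \<Longrightarrow> 0 \<le> g x"
    and "\<And>x. x \<in> A \<Longrightarrow> \<bar>a x\<bar> \<le> M"
  shows "(\<lambda>x. a x * g x) summable_on A"
    and "\<bar>\<Sum>\<^sub>\<infinity>x\<in>A. a x * g x\<bar> \<le> M * (\<Sum>\<^sub>\<infinity>x\<in>A. g x)"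
proof -
  have dom: "norm (a x * g x) \<le> M * g x" if "x \<in> A" for x
    using assms(2,3)[OF that] by (simp add: abs_mult mult_right_mono)
  have Mg: "(\<lambda>x. M * g x) summable_on A"
    using assms(1) by (rule summable_on_cmult_right)
  have abs: "(\<lambda>x. norm (a x * g x)) summable_on A"
    using Mg dom by (rule Infinite_Sum.abs_summable_on_comparison_test')
  then show "(\<lambda>x. a x * g x) summable_on A"
    by (rule abs_summable_summable)
  have "norm (\<Sum>\<^sub>\<infinity>x\<in>A. a x * g x) \<le> (\<Sum>\<^sub>\<infinity>x\<in>A. norm (a x * g x))"
    using abs by (rule norm_infsum_bound)
  also have "\<dots> \<le> (\<Sum>\<^sub>\<infinity>x\<in>A. M * g x)"
    using abs Mg dom by (rule infsum_mono)
  finally show "\<bar>\<Sum>\<^sub>\<infinity>x\<in>A. a x * g x\<bar> \<le> M * (\<Sum>\<^sub>\<infinity>x\<in>A. g x)"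
    by (simp add: infsum_cmult_right')
qed

text \<open>The leading term decides: if the coefficients below \<open>n\<close> vanish, then the \<open>n\<close>-th term has to cancel against the tail.
  As \<open>u\<close> grows, the tail decays like \<open>(n + 1) powr - u\<close>, hence faster than \<open>n powr - u\<close>, so the
  \<open>n\<close>-th coefficient vanishes as well.\<close>

lemma dirichlet_coeffs_zero:
  fixes b :: "nat \<Rightarrow> real"
  assumes bound: "\<And>n. 1 \<le> n \<Longrightarrow> \<bar>b n\<bar> \<le> B"
    and zero: "\<And>u. 1 < u \<Longrightarrow> (\<Sum>\<^sub>\<infinity>n\<in>{1..}. b n * real n powr - u) = 0"
    and "1 \<le> n"
  shows "b n = 0"
  using \<open>1 \<le> n\<close>
proof (induction n rule: less_induct)
  case (less n)
  define Z where "Z = (\<Sum>\<^sub>\<infinity>k\<in>{Suc n..}. real k powr - 2)"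
  define r where "r = real n / real (Suc n)"
  have B0: "0 \<le> B"
    using bound[of 1] by simp
  \<comment> \<open>Integer exponents \<open>m \<ge> 2\<close> suffice for the limit.  Of the factor \<open>k powr - m\<close> in the tail,
    \<open>k powr - 2\<close> is kept to make the sum \<open>Z\<close> converge; the rest is largest at \<open>k = Suc n\<close>.\<close>
  have bound_pow: "\<bar>b n\<bar> \<le> B * Z * (real (Suc n))\<^sup>2 * r ^ m" if "2 \<le> m" for m
  proof -
    define u where "u = real m"
    have u: "2 \<le> u" using that by (simp add: u_def)
    let ?t = "\<lambda>k. real k powr - u"
    have b: "\<bar>b k\<bar> \<le> B" if "k \<in> {Suc n..}" for k
      using bound that by auto
    have summ: "?t summable_on A" for A
      using u by (intro powr_neg_summable_on) auto
    have bsumm: "(\<lambda>k. b k * ?t k) summable_on {Suc n..}"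
      by (rule bounded_times_summable_on(1)[OF summ _ b]) auto
    have "0 = (\<Sum>\<^sub>\<infinity>k\<in>{1..}. b k * ?t k)"
      using zero[of u] u by simp
    also have "\<dots> = (\<Sum>\<^sub>\<infinity>k\<in>insert n {Suc n..}. b k * ?t k)"
      using less by (intro infsum_cong_neutral) auto
    also have "\<dots> = b n * ?t n + (\<Sum>\<^sub>\<infinity>k\<in>{Suc n..}. b k * ?t k)"
      using bsumm by (subst infsum_insert) auto
    finally have "\<bar>b n\<bar> * ?t n = \<bar>\<Sum>\<^sub>\<infinity>k\<in>{Suc n..}. b k * ?t k\<bar>"
      by (metis abs_minus_cancel abs_mult abs_of_nonneg add_eq_0_iff powr_ge_zero)
    also have "\<dots> \<le> B * (\<Sum>\<^sub>\<infinity>k\<in>{Suc n..}. ?t k)"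
      by (rule bounded_times_summable_on(2)[OF summ _ b]) auto
    also have "(\<Sum>\<^sub>\<infinity>k\<in>{Suc n..}. ?t k)
        \<le> (\<Sum>\<^sub>\<infinity>k\<in>{Suc n..}. real (Suc n) powr (2 - u) * real k powr - 2)"
    proof (rule infsum_mono)
      fix k assume "k \<in> {Suc n..}"
      then have k: "Suc n \<le> k" by simp
      have "real k powr - u = real k powr (2 - u) * real k powr - 2"
        by (simp flip: powr_add)
      also have "\<dots> \<le> real (Suc n) powr (2 - u) * real k powr - 2"
        using k u by (intro mult_right_mono powr_mono2') auto
      finally show "real k powr - u \<le> real (Suc n) powr (2 - u) * real k powr - 2" .
    qed (auto intro!: summ summable_on_cmult_right powr_neg_summable_on)
    also have "\<dots> = real (Suc n) powr (2 - u) * Z"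
      by (simp add: infsum_cmult_right' Z_def)
    finally have main: "\<bar>b n\<bar> * real n powr - u \<le> B * (real (Suc n) powr (2 - u) * Z)"
      using B0 by (simp add: mult_left_mono)
    have "\<bar>b n\<bar> = \<bar>b n\<bar> * real n powr - u * real n ^ m"
      using less.prems by (simp add: u_def powr_minus powr_realpow)
    also have "\<dots> \<le> B * (real (Suc n) powr (2 - u) * Z) * real n ^ m"
      using main by (rule mult_right_mono) simp
    also have "real (Suc n) powr (2 - u) = (real (Suc n))\<^sup>2 / real (Suc n) ^ m"
      by (simp add: powr_diff u_def powr_realpow)
    also have "B * ((real (Suc n))\<^sup>2 / real (Suc n) ^ m * Z) * real n ^ m
        = B * Z * (real (Suc n))\<^sup>2 * r ^ m"
      unfolding r_def power_divide by simp
    finally show ?thesis .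
  qed
  have "(\<lambda>m. r ^ m) \<longlonglongrightarrow> 0"
    by (rule LIMSEQ_power_zero) (simp add: r_def)
  then have "(\<lambda>m. B * Z * (real (Suc n))\<^sup>2 * r ^ m) \<longlonglongrightarrow> 0"
    by (rule tendsto_mult_right_zero)
  then have "\<bar>b n\<bar> \<le> 0"
    by (rule LIMSEQ_le_const) (use bound_pow in blast)
  then show ?case by simp
qed

lemma prod_powr_neg_summable_on_PiE:
  assumes "finite F" and "\<And>j. j \<in> F \<Longrightarrow> 1 < s j"
  shows "(\<lambda>f. \<Prod>j\<in>F. real (f j) powr - s j) summable_on (F \<rightarrow>\<^sub>E {1..})"
proof -
  have "Infinite_Set_Sum.abs_summable_on (\<lambda>n. real n powr - s j) {1..}" if "j \<in> F" for j
    unfolding abs_summable_equivalent[symmetric]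
    using powr_neg_summable_on[OF assms(2)[OF that]] by simp
  then have "Infinite_Set_Sum.abs_summable_on
      (\<lambda>f. \<Prod>j\<in>F. real (f j) powr - s j) (F \<rightarrow>\<^sub>E {1..})"
    using assms(1) by (intro abs_summable_on_prod_PiE) auto
  then show ?thesis
    unfolding abs_summable_equivalent[symmetric] by (rule abs_summable_summable)
qed

text \<open>Separating one variable turns the series into an ordinary Dirichlet series whose coefficients
  are Dirichlet series in the remaining variables; the one-variable result kills those coefficients
  for all values of the remaining variables.\<close>

lemma multi_dirichlet_coeffs_zero:
  fixes a :: "('a \<Rightarrow> nat) \<Rightarrow> real"
  assumes "finite F"
    and "\<And>f. f \<in> F \<rightarrow>\<^sub>E {1..} \<Longrightarrow> \<bar>a f\<bar> \<le> M"
    and "\<And>s. (\<forall>j\<in>F. 1 < s j) \<Longrightarrow>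
           (\<Sum>\<^sub>\<infinity>f\<in>F \<rightarrow>\<^sub>E {1..}. a f * (\<Prod>j\<in>F. real (f j) powr - s j)) = 0"
    and "f \<in> F \<rightarrow>\<^sub>E {1..}"
  shows "a f = 0"
  using assms
proof (induction F arbitrary: a f rule: finite_induct)
  case empty
  then show ?case by simp
next
  case (insert x F)
  let ?E = "F \<rightarrow>\<^sub>E {1::nat..}"
  let ?\<pi> = "\<lambda>s g. \<Prod>j\<in>F. real (g j) powr - s j"
  let ?b = "\<lambda>s n. \<Sum>\<^sub>\<infinity>g\<in>?E. a (g(x := n)) * ?\<pi> s g"
  have upd: "g(x := n) \<in> insert x F \<rightarrow>\<^sub>E {1..}" if "1 \<le> n" "g \<in> ?E" for g n
    using that by (auto simp: PiE_iff extensional_def)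
  have coeff_bound: "\<bar>a (g(x := n))\<bar> \<le> M" if "1 \<le> n" "g \<in> ?E" for g n
    using insert.prems(1) upd[OF that] by blast
  have b_zero: "?b s n = 0" if s: "\<forall>j\<in>F. 1 < s j" and n: "1 \<le> n" for s n
  proof (rule dirichlet_coeffs_zero[of "?b s", OF _ _ n])
    have summ: "?\<pi> s summable_on ?E"
      using insert.hyps s by (intro prod_powr_neg_summable_on_PiE) auto
    show "\<bar>?b s k\<bar> \<le> M * (\<Sum>\<^sub>\<infinity>g\<in>?E. ?\<pi> s g)" if "1 \<le> k" for k
      using coeff_bound[OF that]
      by (intro bounded_times_summable_on(2) summ prod_nonneg) auto
    fix u :: real assume u: "1 < u"
    define t where "t = s(x := u)"
    have t: "\<forall>j\<in>insert x F. 1 < t j"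
      using s u by (simp add: t_def)
    let ?h = "\<lambda>f. a f * (\<Prod>j\<in>insert x F. real (f j) powr - t j)"
    let ?upd = "\<lambda>(n, g). g(x := n)"
    have inj: "inj_on ?upd ({1..} \<times> ?E)"
      using insert.hyps(2) by (rule inj_combinator)
    have img: "insert x F \<rightarrow>\<^sub>E {1..} = ?upd ` ({1..} \<times> ?E)"
      by (rule PiE_insert_eq)
    have h_upd: "?h (?upd (k, g)) = a (g(x := k)) * ?\<pi> s g * real k powr - u" for k g
    proof -
      have "(\<Prod>j\<in>F. real ((g(x := k)) j) powr - t j) = ?\<pi> s g"
        using insert.hyps(2) by (intro prod.cong) (auto simp: t_def)
      then show ?thesis
        using insert.hyps by (simp add: t_def)
    qed
    have "?h summable_on (insert x F \<rightarrow>\<^sub>E {1..})"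
      using insert.hyps(1) t insert.prems(1)
      by (intro bounded_times_summable_on(1) prod_powr_neg_summable_on_PiE prod_nonneg) auto
    then have sumprod: "(?h \<circ> ?upd) summable_on ({1..} \<times> ?E)"
      unfolding img using inj by (simp only: summable_on_reindex)
    have "0 = infsum ?h (insert x F \<rightarrow>\<^sub>E {1..})"
      using insert.prems(2)[OF t] by simp
    also have "\<dots> = infsum (?h \<circ> ?upd) ({1..} \<times> ?E)"
      unfolding img using inj by (rule infsum_reindex)
    also have "\<dots> = (\<Sum>\<^sub>\<infinity>k\<in>{1..}. \<Sum>\<^sub>\<infinity>g\<in>?E. (?h \<circ> ?upd) (k, g))"
      using sumprod by (rule infsum_Sigma_banach[symmetric])
    also have "\<dots> = (\<Sum>\<^sub>\<infinity>k\<in>{1..}. ?b s k * real k powr - u)"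
      unfolding o_def h_upd by (simp only: infsum_cmult_left')
    finally show "(\<Sum>\<^sub>\<infinity>k\<in>{1..}. ?b s k * real k powr - u) = 0"
      by simp
  qed
  obtain n g where f: "f = g(x := n)" and ng: "1 \<le> n" "g \<in> ?E"
    using insert.prems(3) unfolding PiE_insert_eq by auto
  have "a (g(x := n)) = 0"
    using coeff_bound[OF ng(1)] b_zero[OF _ ng(1)] ng(2)
    by (rule insert.IH[where a = "\<lambda>g. a (g(x := n))"])
  then show ?case
    unfolding f .
qed

section \<open>Multiple zeta values as sums over functions\<close>

definition descending_values :: "'a set \<Rightarrow> ('a \<Rightarrow> nat) \<Rightarrow> nat list" where
  "descending_values F f = rev (sorted_list_of_set (f ` F))"

definition level_partition :: "'a set \<Rightarrow> ('a \<Rightarrow> nat) \<Rightarrow> 'a set list" where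
  "level_partition F f = map (\<lambda>v. {j\<in>F. f j = v}) (descending_values F f)"

lemma sorted_wrt_descending_values: "sorted_wrt (>) (descending_values F f)"
  by (simp add: descending_values_def sorted_wrt_rev)

lemma set_descending_values: "finite F \<Longrightarrow> set (descending_values F f) = f ` F"
  by (simp add: descending_values_def)

lemma sorted_desc_set_unique:
  fixes xs ys :: "nat list"
  assumes "sorted_wrt (>) xs" "sorted_wrt (>) ys" "set xs = set ys"
  shows "xs = ys"
proof -
  have "rev xs = rev ys"
    using assms by (intro strict_sorted_equal) (auto simp: sorted_wrt_rev)
  then show ?thesis by simp
qed

lemma sorted_desc_distinct: "sorted_wrt (>) (xs :: nat list) \<Longrightarrow> distinct xs"
  using strict_sorted_iff[of "rev xs"] by (simp add: sorted_wrt_rev)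

lemma length_level_partition [simp]:
  "length (level_partition F f) = length (descending_values F f)"
  by (simp add: level_partition_def)

lemma level_partition_nth:
  "i < length (descending_values F f) \<Longrightarrow>
     level_partition F f ! i = {j\<in>F. f j = descending_values F f ! i}"
  by (simp add: level_partition_def)

lemma level_partition_in_ordered_set_partitions:
  assumes "finite F"
  shows "level_partition F f \<in> ordered_set_partitions F"
proof -
  let ?vs = "descending_values F f"
  have d: "distinct ?vs"
    by (simp add: sorted_desc_distinct sorted_wrt_descending_values)
  have vs: "set ?vs = f ` F"
    using assms by (rule set_descending_values)
  have "level_partition F f ! i \<noteq> {}" if "i < length ?vs" for i
  proof -
    have "?vs ! i \<in> f ` F" using that vs nth_mem by metis
    then show ?thesis using that by (auto simp: level_partition_nth)
  qed
  moreover have "level_partition F f ! i \<inter> level_partition F f ! k = {}"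
    if "i < length ?vs" "k < length ?vs" "i \<noteq> k" for i k
    using that d by (auto simp: level_partition_nth nth_eq_iff_index_eq)
  moreover have "(\<Union>i<length ?vs. level_partition F f ! i) = F"
  proof (intro equalityI subsetI)
    fix j assume "j \<in> F"
    then have "f j \<in> set ?vs" by (simp add: vs)
    then obtain i where "i < length ?vs" "?vs ! i = f j"
      by (auto simp: in_set_conv_nth)
    then show "j \<in> (\<Union>i<length ?vs. level_partition F f ! i)"
      using \<open>j \<in> F\<close> by (intro UN_I[of i]) (auto simp: level_partition_nth)
  qed (auto simp: level_partition_nth)
  ultimately show ?thesis
    by (simp add: ordered_set_partitions_def)
qed

text \<open>The inverse construction: assign the \<open>i\<close>-th entry of \<open>ks\<close> to all elements of the \<open>i\<close>-th block.
  Since \<open>ks\<close> is strictly decreasing, distinct blocks receive distinct values, and the blocks come back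
  as level sets in their original order.\<close>

lemma level_partition_realizes_values:
  assumes P: "P \<in> ordered_set_partitions F"
    and ks: "ks \<in> decreasing_tuples (length P)"
  obtains f where "f \<in> F \<rightarrow>\<^sub>E {1..}" "level_partition F f = P" "descending_values F f = ks"
proof -
  have ne: "P ! i \<noteq> {}" if "i < length P" for i
    using P that by (simp add: ordered_set_partitions_def)
  have dj: "i = k" if "i < length P" "k < length P" "j \<in> P ! i" "j \<in> P ! k" for i k j
    using P that by (auto simp: ordered_set_partitions_def)
  have un: "(\<Union>i<length P. P ! i) = F"
    using P by (simp add: ordered_set_partitions_def)
  have len: "length ks = length P" and sorted: "sorted_wrt (>) ks"
    and pos: "\<And>k. k \<in> set ks \<Longrightarrow> 0 < k"
    using ks by (auto simp: decreasing_tuples_def)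
  define f where "f = (\<lambda>j\<in>F. ks ! (SOME i. i < length P \<and> j \<in> P ! i))"
  have f_eq: "f j = ks ! i" if "i < length P" "j \<in> P ! i" for i j
  proof -
    have "(SOME i. i < length P \<and> j \<in> P ! i) = i"
      using that dj by (intro some_equality) blast+
    moreover have "j \<in> F" using that un by blast
    ultimately show ?thesis by (simp add: f_def)
  qed
  have f_range: "\<exists>i<length P. j \<in> P ! i \<and> f j = ks ! i" if "j \<in> F" for j
    using that un f_eq by blast
  have "f ` F = set ks"
  proof (intro equalityI subsetI)
    fix v assume "v \<in> f ` F"
    then show "v \<in> set ks" using f_range len by (metis imageE nth_mem)
  next
    fix v assume "v \<in> set ks"
    then obtain i where i: "i < length P" "v = ks ! i"
      by (auto simp: in_set_conv_nth len)
    then obtain j where j: "j \<in> P ! i" using ne by blast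
    then have "v = f j" "j \<in> F" using i f_eq un by auto
    then show "v \<in> f ` F" by (rule image_eqI)
  qed
  then have vs: "descending_values F f = ks"
    using sorted by (intro sorted_desc_set_unique)
      (auto simp: descending_values_def sorted_wrt_rev)
  moreover have "level_partition F f = P"
  proof (rule nth_equalityI)
    fix i assume "i < length (level_partition F f)"
    then have i: "i < length P" by (simp add: vs len)
    have "{j\<in>F. f j = ks ! i} = P ! i"
    proof (intro equalityI subsetI)
      fix j assume "j \<in> {j\<in>F. f j = ks ! i}"
      then have "j \<in> F" "f j = ks ! i" by auto
      then obtain k where k: "k < length P" "j \<in> P ! k" "ks ! i = ks ! k"
        using f_range by metis
      then have "k = i"
        using i sorted_desc_distinct[OF sorted] len by (simp add: nth_eq_iff_index_eq)
      then show "j \<in> P ! i" using k by simp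
    qed (use i f_eq un in blast)
    then show "level_partition F f ! i = P ! i"
      using i by (simp add: level_partition_nth vs len)
  qed (simp add: vs len)
  moreover have "f \<in> F \<rightarrow>\<^sub>E {1..}"
  proof -
    have "1 \<le> f j" if "j \<in> F" for j
      using f_range[OF that] pos len by (metis One_nat_def Suc_leI nth_mem)
    then show ?thesis by (auto simp: f_def)
  qed
  ultimately show ?thesis using that by blast
qed

text \<open>A function is determined by its level sets together with its values on them, so the
  summation ranges of a multiple zeta value and of the functions inducing \<open>P\<close> correspond.\<close>

lemma bij_betw_descending_values:
  assumes "finite F" and P: "P \<in> ordered_set_partitions F"
  shows "bij_betw (descending_values F)
           {f \<in> F \<rightarrow>\<^sub>E {1..}. level_partition F f = P} (decreasing_tuples (length P))"
proof (rule bij_betw_imageI)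
  let ?L = "{f \<in> F \<rightarrow>\<^sub>E {1..}. level_partition F f = P}"
  show "inj_on (descending_values F) ?L"
  proof (rule inj_onI)
    fix f g assume f: "f \<in> ?L" and g: "g \<in> ?L"
      and eq: "descending_values F f = descending_values F g"
    have "f j = g j" if "j \<in> F" for j
    proof -
      have "f j \<in> set (descending_values F f)"
        using that assms(1) by (simp add: set_descending_values)
      then obtain i where i: "i < length (descending_values F f)" "descending_values F f ! i = f j"
        by (auto simp: in_set_conv_nth)
      then have "j \<in> level_partition F f ! i"
        using that by (simp add: level_partition_nth)
      then have "j \<in> level_partition F g ! i"
        using f g by simp
      then show ?thesis
        using i eq by (simp add: level_partition_nth)
    qed
    then show "f = g"
      using f g by (intro PiE_ext[of f F _ g]) auto
  qed
  show "descending_values F ` ?L = decreasing_tuples (length P)"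
  proof (intro equalityI subsetI)
    fix ks assume "ks \<in> descending_values F ` ?L"
    then obtain f where f: "f \<in> F \<rightarrow>\<^sub>E {1..}" "level_partition F f = P"
      and ks: "ks = descending_values F f"
      by blast
    have "0 < v" if "v \<in> f ` F" for v
      using f(1) that by (auto simp: PiE_iff Suc_le_eq)
    then show "ks \<in> decreasing_tuples (length P)"
      using f(2) assms(1) sorted_wrt_descending_values[of F f]
      by (auto simp: decreasing_tuples_def ks set_descending_values)
  next
    fix ks assume "ks \<in> decreasing_tuples (length P)"
    then show "ks \<in> descending_values F ` ?L"
      using level_partition_realizes_values[OF P] by (metis (mono_tags, lifting) image_eqI mem_Collect_eq)
  qed
qed

text \<open>On the \<open>i\<close>-th block \<open>f\<close> is constant, so the power of that constant with the summed exponent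
  splits into one factor for each element of the block; all blocks together give one factor for each
  element of \<open>F\<close>.\<close>

lemma multi_zeta_eq_sum_over_functions:
  assumes "finite F" and P: "P \<in> ordered_set_partitions F"
  shows "multi_zeta (map (\<lambda>A. \<Sum>j\<in>A. s j) P) =
           (\<Sum>\<^sub>\<infinity>f\<in>{f \<in> F \<rightarrow>\<^sub>E {1..}. level_partition F f = P}. \<Prod>j\<in>F. real (f j) powr - s j)"
proof -
  let ?t = "\<lambda>ks. \<Prod>i<length P. real (ks ! i) powr - (\<Sum>j\<in>P ! i. s j)"
  let ?L = "{f \<in> F \<rightarrow>\<^sub>E {1..}. level_partition F f = P}"
  have "multi_zeta (map (\<lambda>A. \<Sum>j\<in>A. s j) P) = infsum ?t (decreasing_tuples (length P))"
    by (simp add: multi_zeta_def)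
  also have "\<dots> = (\<Sum>\<^sub>\<infinity>f\<in>?L. ?t (descending_values F f))"
    by (rule infsum_reindex_bij_betw[OF bij_betw_descending_values[OF assms], symmetric])
  also have "\<dots> = (\<Sum>\<^sub>\<infinity>f\<in>?L. \<Prod>j\<in>F. real (f j) powr - s j)"
  proof (rule infsum_cong)
    fix f assume "f \<in> ?L"
    then have f: "f \<in> F \<rightarrow>\<^sub>E {1..}" and fP: "level_partition F f = P" by auto
    let ?vs = "descending_values F f"
    have len: "length ?vs = length P" using fP by auto
    have Pi: "P ! i = {j\<in>F. f j = ?vs ! i}" if "i < length P" for i
      using that fP level_partition_nth[of i F f] len by simp
    have un: "(\<Union>i<length P. P ! i) = F"
      and dj: "\<And>i k. i < length P \<Longrightarrow> k < length P \<Longrightarrow> i \<noteq> k \<Longrightarrow> P ! i \<inter> P ! k = {}"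
      using P by (auto simp: ordered_set_partitions_def)
    have "?t ?vs = (\<Prod>i<length P. \<Prod>j\<in>P ! i. real (f j) powr - s j)"
    proof (rule prod.cong)
      fix i assume "i \<in> {..<length P}"
      then have i: "i < length P" by simp
      have "?vs ! i \<in> f ` F"
        using i len assms(1) by (metis nth_mem set_descending_values)
      then have "real (?vs ! i) \<noteq> 0"
        using f by (auto simp: PiE_iff Suc_le_eq)
      then have "real (?vs ! i) powr - (\<Sum>j\<in>P ! i. s j) = (\<Prod>j\<in>P ! i. real (?vs ! i) powr - s j)"
        by (simp add: powr_sum flip: sum_negf)
      also have "\<dots> = (\<Prod>j\<in>P ! i. real (f j) powr - s j)"
        using Pi[OF i] by (intro prod.cong) auto
      finally show "real (?vs ! i) powr - (\<Sum>j\<in>P ! i. s j) = (\<Prod>j\<in>P ! i. real (f j) powr - s j)" .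
    qed simp
    also have "\<dots> = (\<Prod>j\<in>(\<Union>i<length P. P ! i). real (f j) powr - s j)"
      using Pi assms(1) dj by (intro prod.UNION_disjoint[symmetric]) auto
    also have "\<dots> = (\<Prod>j\<in>F. real (f j) powr - s j)"
      by (simp only: un)
    finally show "?t ?vs = (\<Prod>j\<in>F. real (f j) powr - s j)" .
  qed
  finally show ?thesis .
qed

lemma ordered_set_partition_is_level_partition:
  assumes "P \<in> ordered_set_partitions F"
  obtains f where "f \<in> F \<rightarrow>\<^sub>E {1..}" "level_partition F f = P"
proof -
  have "rev [1..<Suc (length P)] \<in> decreasing_tuples (length P)"
    by (auto simp: decreasing_tuples_def sorted_wrt_rev simp del: upt_Suc)
  then show ?thesis
    using level_partition_realizes_values[OF assms] that by blast
qed

section \<open>Linear independence of the multiple zeta functions\<close>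

theorem theorem2:
  fixes F :: "nat set" and c :: "nat set list \<Rightarrow> real"
  assumes "finite F" and "F \<noteq> {}" and "\<forall>j\<in>F. 0 < j"
    and "\<forall>s :: nat \<Rightarrow> real. (\<forall>j\<in>F. 1 < s j) \<longrightarrow>
           (\<Sum>P\<in>ordered_set_partitions F. c P * multi_zeta (map (\<lambda>A. \<Sum>j\<in>A. s j) P)) = 0"
  shows "\<forall>P\<in>ordered_set_partitions F. c P = 0"
proof
  fix P assume "P \<in> ordered_set_partitions F"
  then obtain f where f: "f \<in> F \<rightarrow>\<^sub>E {1..}" "level_partition F f = P"
    by (rule ordered_set_partition_is_level_partition)
  let ?O = "ordered_set_partitions F"
  let ?L = "\<lambda>P. {f \<in> F \<rightarrow>\<^sub>E {1..}. level_partition F f = P}"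
  let ?a = "\<lambda>f. c (level_partition F f)"
  have fin: "finite ?O"
    using assms(1) by (rule finite_ordered_set_partitions)
  have lp: "level_partition F f \<in> ?O" for f
    using assms(1) by (rule level_partition_in_ordered_set_partitions)
  have bound: "\<bar>?a f\<bar> \<le> (\<Sum>Q\<in>?O. \<bar>c Q\<bar>)" for f
    using fin lp by (intro member_le_sum) auto
  have "?a f = 0"
  proof (rule multi_dirichlet_coeffs_zero[OF assms(1) bound _ f(1)])
    fix s :: "nat \<Rightarrow> real" assume s: "\<forall>j\<in>F. 1 < s j"
    let ?\<pi> = "\<lambda>f. \<Prod>j\<in>F. real (f j) powr - s j"
    have summ: "(\<lambda>f. ?a f * ?\<pi> f) summable_on (F \<rightarrow>\<^sub>E {1..})"
      using assms(1) s bound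
      by (intro bounded_times_summable_on(1) prod_powr_neg_summable_on_PiE prod_nonneg) auto
    have "0 = (\<Sum>Q\<in>?O. c Q * multi_zeta (map (\<lambda>A. \<Sum>j\<in>A. s j) Q))"
      using assms(4) s by simp
    also have "\<dots> = (\<Sum>Q\<in>?O. \<Sum>\<^sub>\<infinity>f\<in>?L Q. ?a f * ?\<pi> f)"
    proof (rule sum.cong)
      fix Q assume Q: "Q \<in> ?O"
      have "c Q * multi_zeta (map (\<lambda>A. \<Sum>j\<in>A. s j) Q) = (\<Sum>\<^sub>\<infinity>f\<in>?L Q. c Q * ?\<pi> f)"
        by (simp only: multi_zeta_eq_sum_over_functions[OF assms(1) Q] infsum_cmult_right')
      also have "\<dots> = (\<Sum>\<^sub>\<infinity>f\<in>?L Q. ?a f * ?\<pi> f)"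
        by (rule infsum_cong) auto
      finally show "c Q * multi_zeta (map (\<lambda>A. \<Sum>j\<in>A. s j) Q) = (\<Sum>\<^sub>\<infinity>f\<in>?L Q. ?a f * ?\<pi> f)" .
    qed simp
    also have "\<dots> = (\<Sum>\<^sub>\<infinity>f\<in>(\<Union>Q\<in>?O. ?L Q). ?a f * ?\<pi> f)"
      using summ by (intro sum_infsum fin summable_on_subset[OF summ]) auto
    also have "(\<Union>Q\<in>?O. ?L Q) = F \<rightarrow>\<^sub>E {1..}"
      using lp by auto
    finally show "(\<Sum>\<^sub>\<infinity>f\<in>F \<rightarrow>\<^sub>E {1..}. ?a f * ?\<pi> f) = 0"
      by simp
  qed
  then show "c P = 0"
    by (simp add: f(2))
qed

end
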